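(* Suppose $X=A\cup B$ is a decomposable continuum, where each of $A$ and $B$ is a proper subcontinuum of $X$. Then $X$ is a 2-to-1 retract if and only if at least one of the following is true: (i) $A$ is a 2-to-1 retract; (ii) $B$ is a 2-to-1 retract; (iii) $A\cap B$ is not connected.
   Context: A continuum is a (nonempty) connected, compact metric space. A continuum is decomposable if it is the union of two proper subcontinua. A function is 2-to-1 if the preimage of each point of its image has exactly two points. A continuum $Y$ is a 2-to-1 retract if there is a continuum $Z$ and a continuous 2-to-1 retraction from $Z$ onto a subcontinuum of $Z$ that is homeomorphic to $Y$. *)

theory Defs
  imports "HOL-Analysis.Analysis"
begin

definition continuum :: "'a::metric_space set \<Rightarrow> bool" where
  "continuum X \<longleftrightarrow> X \<noteq> {} \<and> connected X \<and> compact X"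

definition proper_subcontinuum :: "'a::metric_space set \<Rightarrow> 'a set \<Rightarrow> bool" where
  "proper_subcontinuum A X \<longleftrightarrow> continuum A \<and> A \<subset> X"

definition decomposable_continuum :: "'a::metric_space set \<Rightarrow> bool" where
  "decomposable_continuum X \<longleftrightarrow> continuum X \<and>
     (\<exists>A B. proper_subcontinuum A X \<and> proper_subcontinuum B X \<and> X = A \<union> B)"

definition two_to_one_on :: "'a set \<Rightarrow> ('a \<Rightarrow> 'b) \<Rightarrow> bool" where
  "two_to_one_on Z f \<longleftrightarrow> (\<forall>w\<in>f ` Z. card {z\<in>Z. f z = w} = 2)"

text \<open>
  The definition of a 2-to-1 retract quantifies over all continua \<open>Z\<close>, which HOL can only do
  for sets \<open>Z\<close> of one fixed type. Every continuum is homeomorphic to a subset of the space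
  \<^typ>\<open>nat \<Rightarrow> real\<close> of real sequences with the product topology, so nothing is lost by taking
  \<open>Z\<close> there; lemma \<open>two_to_one_retractI\<close> below shows that a witness in any other metric space
  will do as well.
\<close>

definition two_to_one_retract :: "'a::metric_space set \<Rightarrow> bool" where
  "two_to_one_retract Y \<longleftrightarrow>
     (\<exists>(Z :: (nat \<Rightarrow> real) set) W r.
        continuum Z \<and> continuum W \<and> W \<subseteq> Z \<and> W homeomorphic Y \<and>
        retraction Z W r \<and> two_to_one_on Z r)"

lemma continuum_homeomorphism:
  assumes "homeomorphism S T f g" "continuum S"
  shows "continuum T"
proof -
  have "f ` S = T" "continuous_on S f"
    using assms(1) by (auto simp: homeomorphism_def)
  then show ?thesis
    using assms(2) compact_continuous_image[of S f] connected_continuous_image[of S f]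
    unfolding continuum_def by auto
qed

lemma compact_homeomorphic_sequences:
  fixes S :: "'a::metric_space set"
  assumes "compact S"
  shows "\<exists>(f :: 'a \<Rightarrow> nat \<Rightarrow> real) g. homeomorphism S (f ` S) f g"
proof -
  have "\<exists>k. finite k \<and> S \<subseteq> (\<Union>x\<in>k. ball x (1 / real (Suc n)))" for n
  proof -
    have "(0::real) < 1 / real (Suc n)" by simp
    then show ?thesis
      using assms unfolding compact_eq_totally_bounded by blast
  qed
  then obtain K where K: "\<And>n. finite (K n)"
      "\<And>n. S \<subseteq> (\<Union>x\<in>K n. ball x (1 / real (Suc n)))"
    by metis
  define D where "D = insert undefined (\<Union>n. K n)"
  have "countable D" "D \<noteq> {}"
    using K(1) by (simp_all add: D_def countable_finite)
  then have dD: "range (from_nat_into D) = D"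
    by (simp add: range_from_nat_into)
  define d where "d = from_nat_into D"
  define f :: "'a \<Rightarrow> nat \<Rightarrow> real" where "f = (\<lambda>x n. dist x (d n))"
  have cont: "continuous_on S f"
    unfolding f_def
    by (intro continuous_on_coordinatewise_then_product continuous_intros)
  have inj: "inj_on f S"
  proof (rule inj_onI, rule ccontr)
    fix x y assume x: "x \<in> S" and y: "y \<in> S" and eq: "f x = f y" and "x \<noteq> y"
    then have "0 < dist x y / 2" by simp
    then obtain n where n: "1 / real (Suc n) < dist x y / 2"
      using nat_approx_posE by blast
    obtain c where c: "c \<in> K n" "dist c x < 1 / real (Suc n)"
      using K(2)[of n] x by auto
    then have "c \<in> range d" using dD by (auto simp: D_def d_def)
    then obtain m where m: "c = d m" by auto
    have "dist x c = dist y c"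
      using fun_cong[OF eq, of m] by (simp add: f_def m)
    moreover have "dist x y \<le> dist x c + dist y c"
      by (rule dist_triangle2)
    ultimately have "dist x y \<le> 2 * dist c x"
      by (simp add: dist_commute[of c x])
    then show False using c n by linarith
  qed
  show ?thesis
    using homeomorphism_compact[OF assms cont refl inj] by blast
qed

lemma two_to_one_retractI:
  fixes Z :: "'b::metric_space set" and Y :: "'a::metric_space set"
  assumes Z: "continuum Z" and W: "continuum W" "W \<subseteq> Z" "W homeomorphic Y"
    and r: "retraction Z W r" "two_to_one_on Z r"
  shows "two_to_one_retract Y"
proof -
  obtain f :: "'b \<Rightarrow> nat \<Rightarrow> real" and g where fg: "homeomorphism Z (f ` Z) f g"
    using compact_homeomorphic_sequences Z unfolding continuum_def by blast
  have gf: "g (f z) = z" if "z \<in> Z" for z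
    using fg that by (auto simp: homeomorphism_def)
  have fgW: "homeomorphism W (f ` W) f g"
    using fg W(2) by (rule homeomorphism_of_subsets) auto
  define s where "s = f \<circ> r \<circ> g"
  have rZ: "r z \<in> W" if "z \<in> Z" for z
    using r(1) that by (auto simp: retraction_def)
  have contg: "continuous_on (f ` Z) g" and contf: "continuous_on Z f"
    using fg by (auto simp: homeomorphism_def)
  have gim: "g ` (f ` Z) = Z"
    using fg by (auto simp: homeomorphism_def)
  have "continuous_on (f ` Z) (r \<circ> g)"
    using contg gim r(1) by (intro continuous_on_compose) (auto simp: retraction_def)
  then have "continuous_on (f ` Z) s"
    unfolding s_def comp_assoc
    by (rule continuous_on_compose)
       (use rZ W(2) gf in \<open>auto intro!: continuous_on_subset[OF contf]\<close>)
  then have 1: "retraction (f ` Z) (f ` W) s"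
    using W(2) rZ gf r(1) by (auto simp: retraction_def s_def subset_iff)
  have 2: "two_to_one_on (f ` Z) s"
    unfolding two_to_one_on_def
  proof
    fix w assume "w \<in> s ` f ` Z"
    then obtain z where z: "z \<in> Z" "w = f (r z)" by (auto simp: s_def gf)
    have injf: "f a = f b \<longleftrightarrow> a = b" if "a \<in> Z" "b \<in> Z" for a b
      using gf that by metis
    have "{v \<in> f ` Z. s v = w} = f ` {v\<in>Z. r v = r z}"
      using z rZ W(2) injf by (auto simp: s_def gf subset_iff)
    moreover have "inj_on f {v\<in>Z. r v = r z}"
      using injf by (auto simp: inj_on_def)
    ultimately show "card {v \<in> f ` Z. s v = w} = 2"
      using r(2) z by (auto simp: card_image two_to_one_on_def)
  qed
  have "f ` W homeomorphic Y"
    using fgW W(3) unfolding homeomorphic_def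
    by (meson homeomorphism_symD homeomorphism_compose)
  then show ?thesis
    unfolding two_to_one_retract_def
    using 1 2 continuum_homeomorphism[OF fg Z] continuum_homeomorphism[OF fgW W(1)] W(2)
    by (intro exI[of _ "f ` Z"] exI[of _ "f ` W"] exI[of _ s]) auto
qed

end

theory Submission
  imports Defs
begin

text \<open>
  Let \<open>r\<close> be a 2-to-1 retraction of a continuum \<open>Z\<close> onto \<open>Y\<close>. Every fibre consists of a point of
  \<open>Y\<close> and one further point, so \<open>r\<close> together with the distance to \<open>Y\<close> separates the points of
  \<open>Z\<close>. Hence \<open>Z\<close> may be taken to be the union of the bottom sheet \<open>Y \<times> {0}\<close> and the graph of a
  function \<open>g > 0\<close> on \<open>Y\<close>, an upper sheet, and \<open>Y\<close> is a 2-to-1 retract precisely if some such union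
  is compact and connected. The function \<open>g\<close> is necessarily discontinuous: where it jumps, the upper
  sheet runs into the bottom one.

  It is enough to have the upper sheet over a nonempty compact \<open>V \<subseteq> Y\<close>, because the distance to \<open>V\<close>
  completes it. This shows that a continuum with a subcontinuum that is a 2-to-1 retract is one
  itself. If subcontinua \<open>E\<close> and \<open>F\<close> of \<open>Y\<close> meet in the disjoint union of nonempty compact
  sets \<open>C\<close> and \<open>D\<close>, an upper sheet over \<open>E \<union> F\<close> consists of a copy of \<open>E\<close> attached to the bottom along
  \<open>C\<close> and a copy of \<open>F\<close> attached along \<open>D\<close>. These two observations give one implication.

  For the other one, let \<open>T\<close> be the sheeted set of a 2-to-1 retract \<open>A \<union> B\<close> with \<open>K = A \<inter> B\<close>
  connected, let \<open>TA\<close>, \<open>TB\<close>, \<open>TK\<close> be its parts over \<open>A\<close>, \<open>B\<close>, \<open>K\<close>, and suppose that neither \<open>A\<close> nor \<open>B\<close>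
  is a 2-to-1 retract. Then \<open>TA\<close> has a nonempty clopen subset \<open>Q\<close> that misses the bottom, and \<open>Q\<close>
  meets \<open>TK\<close>, since otherwise it would be clopen in \<open>T\<close>. The aim is a clopen subset \<open>W \<noteq> {}\<close> of \<open>TB\<close>
  off the bottom and a clopen subset \<open>Q1\<close> of \<open>Q\<close> with the same trace on \<open>TK\<close>: then
  \<open>Q1 \<union> W\<close> is clopen in \<open>T\<close>, which contradicts the connectedness of \<open>T\<close>.

  To find \<open>W\<close> (lemma \<open>nonretract_split\<close>), the upper sheet over \<open>B\<close> is rebuilt: the part \<open>TK - Q\<close> is
  collapsed to the bottom, and over the points of \<open>K\<close> that lose their upper point in this way a copy of
  \<open>K\<close>, attached to the bottom along the projection of \<open>Q \<inter> TK\<close>, takes its place. The result is not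
  connected, as \<open>B\<close> is not a 2-to-1 retract; a clopen subset off the bottom cannot meet the
  connected new copy of \<open>K\<close>, so it comes from a clopen subset \<open>W\<close> of \<open>TB\<close> whose trace on \<open>TK\<close> lies in \<open>Q\<close>.
  As for \<open>Q1\<close>, any connected compact subset of \<open>Q\<close> is a copy of a subcontinuum of \<open>A\<close>; that subcontinuum
  meets \<open>K\<close> in a connected set, as \<open>A\<close> is not a 2-to-1 retract. So no connected subset of \<open>Q\<close> meets
  both the trace of \<open>W\<close> and the rest of \<open>Q \<inter> TK\<close>, and the cut wire theorem separates the two.
\<close>

section \<open>Splitting compact sets into two compact pieces\<close>

lemma connected_compact_split:
  fixes T :: "'a::metric_space set"
  assumes "connected T" "Q \<subseteq> T" "compact Q" "compact (T - Q)"
  shows "Q = {} \<or> Q = T"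
proof (rule ccontr)
  assume "\<not> ?thesis"
  then have "Q \<inter> (T - Q) \<noteq> {}"
    using assms by (intro connected_as_closed_union[of T]) (auto intro: compact_imp_closed)
  then show False by blast
qed

text \<open>The connected set \<open>S\<close> lies in one of the two halves of a separation; the other half is
  \<open>Q\<close>. In the applications \<open>S\<close> is a bottom sheet or empty.\<close>

lemma disconnected_compact_split:
  fixes T :: "'a::metric_space set"
  assumes "compact T" "\<not> connected T" "connected S" "S \<subseteq> T"
  obtains Q where "Q \<subseteq> T" "Q \<noteq> {}" "Q \<noteq> T" "compact Q" "compact (T - Q)" "S \<inter> Q = {}"
proof -
  obtain P Q where PQ: "closed P" "closed Q" "P \<noteq> {}" "Q \<noteq> {}" "P \<union> Q = T" "P \<inter> Q = {}"
    using assms connected_closed_set[of T] compact_imp_closed by metis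
  have T: "T - Q = P" "T - P = Q"
    using PQ by auto
  have c: "compact P" "compact Q"
    using PQ assms(1) by (metis Un_upper1 Un_upper2 closed_Int_compact inf.absorb1)+
  have "S \<inter> P = {} \<or> S \<inter> Q = {}"
    using assms(3,4) PQ unfolding connected_closed by (metis Int_commute inf_bot_right inf_left_commute)
  then show ?thesis
    using that[of P] that[of Q] PQ T c by auto
qed

text \<open>A form of the cut wire theorem. It suffices to test compact connected sets, because the
  closure of a connected subset of \<open>Q\<close> is a compact connected subset of \<open>Q\<close>.\<close>

lemma compact_cut_wire:
  fixes Q :: "'a::metric_space set"
  assumes Q: "compact Q" and F: "compact F1" "compact F2" "F1 \<subseteq> Q" "F2 \<subseteq> Q"
    and no: "\<And>L. \<lbrakk>L \<subseteq> Q; compact L; connected L\<rbrakk> \<Longrightarrow> L \<inter> F1 = {} \<or> L \<inter> F2 = {}"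
  obtains Q1 where "Q1 \<subseteq> Q" "compact Q1" "compact (Q - Q1)" "F1 \<subseteq> Q1" "Q1 \<inter> F2 = {}"
proof -
  let ?Q = "top_of_set Q"
  have "separated_between ?Q F1 F2"
  proof (rule cut_wire_fence_theorem)
    show "compact_space ?Q"
      using Q by (simp add: compact_space_subtopology)
    show "closedin ?Q F1" "closedin ?Q F2"
      using F by (simp_all add: closed_subset compact_imp_closed)
    fix C assume "connectedin ?Q C"
    then have C: "connected C" "C \<subseteq> Q"
      by (auto simp: connectedin_subtopology)
    then have "closure C \<subseteq> Q"
      using Q by (simp add: closure_minimal compact_imp_closed)
    moreover from this have "compact (closure C)"
      using Q by (metis closed_closure closed_Int_compact inf.absorb1)
    ultimately have "closure C \<inter> F1 = {} \<or> closure C \<inter> F2 = {}"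
      using C(1) no connected_imp_connected_closure by blast
    then show "disjnt C F1 \<or> disjnt C F2"
      using closure_subset[of C] by (auto simp: disjnt_def)
  qed (simp add: Hausdorff_space_subtopology)
  then obtain U V where UV: "closedin ?Q U" "closedin ?Q V" "U \<union> V = Q" "disjnt U V"
      "F1 \<subseteq> U" "F2 \<subseteq> V"
    unfolding separated_between_alt by auto
  then have "Q - U = V" by (auto simp: disjnt_def)
  moreover have "compact U" "compact V"
    using UV(1,2) Q closedin_compact by blast+
  ultimately show ?thesis
    using that[of U] UV by (auto simp: disjnt_def)
qed

section \<open>Two-to-one retracts as sheeted sets\<close>

text \<open>The upper sheet may live over a subset \<open>V\<close> only, so that 2-to-1 retracts can be recognised from
  partial sheets. The case \<open>V = Y\<close> with \<open>g > 0\<close> is the one in which projecting to the bottom is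
  2-to-1.\<close>

definition sheets :: "'a set \<Rightarrow> 'a set \<Rightarrow> ('a \<Rightarrow> real) \<Rightarrow> ('a \<times> real) set" where
  "sheets Y V g = Y \<times> {0} \<union> (\<lambda>y. (y, g y)) ` V"

lemma compact_graph:
  fixes V :: "'a::metric_space set" and h :: "'a \<Rightarrow> real"
  assumes "compact V" "continuous_on V h"
  shows "compact ((\<lambda>y. (y, h y)) ` V)"
  using assms by (intro compact_continuous_image continuous_intros)

lemma connected_graph:
  fixes V :: "'a::metric_space set" and h :: "'a \<Rightarrow> real"
  assumes "connected V" "continuous_on V h"
  shows "connected ((\<lambda>y. (y, h y)) ` V)"
  using assms by (intro connected_continuous_image continuous_intros)

lemma continuum_base:
  fixes Y :: "'a::metric_space set"
  assumes "continuum Y"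
  shows "compact (Y \<times> {0::real})" "connected (Y \<times> {0::real})"
  using assms by (auto simp: continuum_def intro: compact_Times connected_Times)

text \<open>The other point of a fibre lies off the image \<open>W\<close> of the retraction, so its distance to \<open>W\<close> is
  positive and distinguishes it from the point of \<open>W\<close> below it. Thus the retraction and the
  distance to \<open>W\<close> together map \<open>Z\<close> onto a sheeted set.\<close>

lemma two_to_one_retract_imp_sheets:
  fixes Y :: "'a::metric_space set"
  assumes "two_to_one_retract Y"
  obtains g where "\<And>y. y \<in> Y \<Longrightarrow> 0 < g y" "compact (sheets Y Y g)" "connected (sheets Y Y g)"
proof -
  obtain Z :: "(nat \<Rightarrow> real) set" and W r where
    Z: "continuum Z" and W: "continuum W" "W \<subseteq> Z" "W homeomorphic Y"
    and r: "retraction Z W r" and two: "two_to_one_on Z r"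
    using assms unfolding two_to_one_retract_def by blast
  obtain h k where hk: "homeomorphism W Y h k"
    using W(3) unfolding homeomorphic_def by blast
  have rW: "r ` Z = W" "continuous_on Z r" "\<And>w. w \<in> W \<Longrightarrow> r w = w"
    using r by (auto simp: retraction)
  have W0: "closed W" "W \<noteq> {}"
    using W(1) by (auto simp: continuum_def compact_imp_closed)
  have h: "h ` W = Y" "continuous_on W h" "\<And>w. w \<in> W \<Longrightarrow> k (h w) = w"
    and k: "k ` Y = W" "\<And>y. y \<in> Y \<Longrightarrow> h (k y) = y"
    using hk by (auto simp: homeomorphism_def)
  have "\<exists>z. z \<notin> W \<and> {u \<in> Z. r u = w} = {w, z}" if "w \<in> W" for w
  proof -
    have "card {u \<in> Z. r u = w} = 2"
      using two that rW(1) by (auto simp: two_to_one_on_def)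
    then obtain a b where ab: "{u \<in> Z. r u = w} = {a, b}" "a \<noteq> b"
      by (auto simp: card_2_iff)
    have "w \<in> {u \<in> Z. r u = w}"
      using that W(2) rW(3) by auto
    then obtain z where z: "{u \<in> Z. r u = w} = {w, z}" "z \<noteq> w"
      using ab by auto
    then have "r z = w" by auto
    then have "z \<notin> W" using z(2) rW(3) by auto
    then show ?thesis using z by blast
  qed
  then obtain s where s: "\<And>w. w \<in> W \<Longrightarrow> s w \<notin> W"
      "\<And>w. w \<in> W \<Longrightarrow> {u \<in> Z. r u = w} = {w, s w}"
    by metis
  define g where "g y = infdist (s (k y)) W" for y
  define \<Phi> where "\<Phi> z = (h (r z), infdist z W)" for z
  have kW: "k y \<in> W" if "y \<in> Y" for y
    using that k by blast
  have pos: "0 < g y" if "y \<in> Y" for y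
    using s(1)[OF kW[OF that]] W0 by (simp add: g_def infdist_pos_not_in_closed)
  have eq: "sheets Y Y g = \<Phi> ` Z"
  proof (intro equalityI subsetI)
    fix p assume "p \<in> sheets Y Y g"
    then obtain y where y: "y \<in> Y" "p = (y, 0) \<or> p = (y, g y)"
      by (auto simp: sheets_def)
    have "k y \<in> {u \<in> Z. r u = k y}" "s (k y) \<in> {u \<in> Z. r u = k y}"
      using s(2)[OF kW[OF y(1)]] by auto
    then have "(y, 0) = \<Phi> (k y)" "(y, g y) = \<Phi> (s (k y))" "k y \<in> Z" "s (k y) \<in> Z"
      using y(1) k(2) kW by (auto simp: \<Phi>_def g_def)
    then show "p \<in> \<Phi> ` Z" using y(2) by blast
  next
    fix p assume "p \<in> \<Phi> ` Z"
    then obtain z where z: "z \<in> Z" "p = \<Phi> z" by blast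
    then have w: "r z \<in> W" using rW(1) by auto
    then have "z \<in> {r z, s (r z)}"
      using s(2)[OF w] z(1) by blast
    moreover have "h (r z) \<in> Y" "k (h (r z)) = r z"
      using w h by auto
    ultimately show "p \<in> sheets Y Y g"
      using z(2) w by (auto simp: sheets_def \<Phi>_def g_def image_iff)
  qed
  have "continuous_on Z (\<lambda>z. h (r z))"
    using continuous_on_compose2[OF h(2) rW(2)] rW(1) by simp
  then have "continuous_on Z \<Phi>"
    unfolding \<Phi>_def by (intro continuous_intros) auto
  then have "compact (\<Phi> ` Z)" "connected (\<Phi> ` Z)"
    using Z by (auto simp: continuum_def intro: compact_continuous_image connected_continuous_image)
  then show ?thesis using that[of g] pos eq by simp
qed

lemma two_to_one_retract_sheetsI:
  fixes Y :: "'a::metric_space set"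
  assumes Y: "continuum Y" and g: "\<And>y. y \<in> Y \<Longrightarrow> 0 < g y"
    and T: "compact (sheets Y Y g)" "connected (sheets Y Y g)"
  shows "two_to_one_retract Y"
proof (rule two_to_one_retractI)
  show "continuum (sheets Y Y g)"
    using T Y by (auto simp: continuum_def sheets_def)
  show "continuum (Y \<times> {0::real})"
    using continuum_base[OF Y] Y by (auto simp: continuum_def)
  show "Y \<times> {0} \<subseteq> sheets Y Y g"
    by (auto simp: sheets_def)
  show "Y \<times> {0::real} homeomorphic Y"
    unfolding homeomorphic_def homeomorphism_def
    by (intro exI[of _ fst] exI[of _ "\<lambda>y. (y, 0)"]) (auto intro!: continuous_intros)
  show "retraction (sheets Y Y g) (Y \<times> {0}) (\<lambda>p. (fst p, 0))"
    by (auto simp: retraction_def sheets_def intro!: continuous_intros)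
  show "two_to_one_on (sheets Y Y g) (\<lambda>p. (fst p, 0::real))"
    unfolding two_to_one_on_def
  proof
    fix w assume "w \<in> (\<lambda>p. (fst p, 0::real)) ` sheets Y Y g"
    then obtain y where y: "y \<in> Y" "w = (y, 0)"
      by (auto simp: sheets_def)
    then have "{p \<in> sheets Y Y g. (fst p, 0) = w} = {(y, 0), (y, g y)}"
      by (auto simp: sheets_def)
    then show "card {p \<in> sheets Y Y g. (fst p, 0) = w} = 2"
      using g[OF y(1)] by simp
  qed
qed

section \<open>Partial sheets and failure of unicoherence\<close>

text \<open>The distance to \<open>V\<close> is positive exactly off \<open>V\<close>. Its graph over \<open>Y\<close> is a copy of \<open>Y\<close> attached
  to the bottom along \<open>V\<close>, so adding it completes the upper sheet without destroying compactness or
  connectedness.\<close>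

lemma two_to_one_retract_partial_sheetI:
  fixes Y :: "'a::metric_space set"
  assumes Y: "continuum Y" and V: "compact V" "V \<noteq> {}" "V \<subseteq> Y"
    and g: "\<And>y. y \<in> V \<Longrightarrow> 0 < g y"
    and T: "compact (sheets Y V g)" "connected (sheets Y V g)"
  shows "two_to_one_retract Y"
proof (rule two_to_one_retract_sheetsI[OF Y])
  define g' where "g' y = (if y \<in> V then g y else infdist y V)" for y
  show "0 < g' y" if "y \<in> Y" for y
    using g V by (simp add: g'_def infdist_pos_not_in_closed compact_imp_closed)
  define D where "D = (\<lambda>y. (y, infdist y V)) ` Y"
  have cont: "continuous_on Y (\<lambda>y. infdist y V)"
    by (intro continuous_intros)
  have D: "compact D" "connected D"
    using Y cont by (auto simp: D_def continuum_def intro: compact_graph connected_graph)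
  obtain v where v: "v \<in> V" using V by blast
  then have "(v, 0) \<in> D"
    using V(3) by (auto simp: D_def image_iff)
  then have meet: "sheets Y V g \<inter> D \<noteq> {}"
    using v V(3) by (auto simp: sheets_def)
  have eq: "sheets Y Y g' = sheets Y V g \<union> D"
  proof (intro equalityI subsetI)
    fix p assume "p \<in> sheets Y V g \<union> D"
    then consider "p \<in> sheets Y V g" | y where "y \<in> Y" "p = (y, infdist y V)"
      by (auto simp: D_def)
    then show "p \<in> sheets Y Y g'"
    proof cases
      case (2 y)
      then show ?thesis
        by (cases "y \<in> V") (auto simp: sheets_def g'_def)
    qed (use V(3) in \<open>auto simp: sheets_def g'_def\<close>)
  qed (auto simp: sheets_def g'_def D_def)
  show "compact (sheets Y Y g')" "connected (sheets Y Y g')"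
    unfolding eq using T D meet by (auto intro: compact_Un connected_Un)
qed

lemma two_to_one_retract_superset:
  fixes Y :: "'a::metric_space set"
  assumes Y: "continuum Y" and A: "continuum A" "A \<subseteq> Y" "two_to_one_retract A"
  shows "two_to_one_retract Y"
proof -
  obtain g where g: "\<And>y. y \<in> A \<Longrightarrow> 0 < g y" "compact (sheets A A g)" "connected (sheets A A g)"
    using A(3) two_to_one_retract_imp_sheets by blast
  have eq: "sheets Y A g = Y \<times> {0} \<union> sheets A A g"
    using A(2) by (auto simp: sheets_def)
  have "Y \<times> {0} \<inter> sheets A A g \<noteq> {}"
    using A(1,2) by (auto simp: sheets_def continuum_def)
  then have "connected (sheets Y A g)" "compact (sheets Y A g)"
    unfolding eq using continuum_base[OF Y] g(2,3) by (blast intro: compact_Un connected_Un)+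
  then show ?thesis
    using A(1,2) g(1) by (intro two_to_one_retract_partial_sheetI[OF Y, of A g]) (auto simp: continuum_def)
qed

text \<open>Split \<open>E \<inter> F\<close> into compact sets \<open>C\<close> and \<open>D\<close>. The graph \<open>GE\<close> of the distance to \<open>C\<close> over \<open>E\<close> and
  the graph \<open>GF\<close> of the distance to \<open>D\<close> over \<open>F\<close> never compete for the upper sheet: over \<open>C\<close> the
  former lies on the bottom, and over \<open>D\<close> the latter does.\<close>

lemma two_to_one_retract_nonunicoherent:
  fixes Y :: "'a::metric_space set"
  assumes Y: "continuum Y" and E: "continuum E" "E \<subseteq> Y" and F: "continuum F" "F \<subseteq> Y"
    and EF: "\<not> connected (E \<inter> F)"
  shows "two_to_one_retract Y"
proof -
  have cEF: "compact E" "compact F" "connected E" "connected F" "compact (E \<inter> F)"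
    using E F by (auto simp: continuum_def intro: compact_Int)
  obtain C where C: "C \<subseteq> E \<inter> F" "C \<noteq> {}" "C \<noteq> E \<inter> F" "compact C" "compact (E \<inter> F - C)"
    using disconnected_compact_split[OF cEF(5) EF, of "{}"] by auto
  define D where "D = E \<inter> F - C"
  have D: "D \<noteq> {}" "compact D" "C \<inter> D = {}" "E \<inter> F = C \<union> D"
    using C by (auto simp: D_def)
  define g where "g y = (if y \<in> E - C then infdist y C else infdist y D)" for y
  define GE where "GE = (\<lambda>y. (y, infdist y C)) ` E"
  define GF where "GF = (\<lambda>y. (y, infdist y D)) ` F"
  have G: "compact GE" "connected GE" "compact GF" "connected GF"
    unfolding GE_def GF_def using cEF
    by (auto intro!: compact_graph connected_graph continuous_intros)
  have pos: "0 < g y" if "y \<in> E \<union> F" for y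
  proof (cases "y \<in> E - C")
    case True
    then show ?thesis
      using C by (simp add: g_def infdist_pos_not_in_closed compact_imp_closed)
  next
    case False
    then have "y \<notin> D"
      using D(3,4) by auto
    then show ?thesis
      using False D(1,2) by (auto simp: g_def infdist_pos_not_in_closed compact_imp_closed)
  qed
  have eq: "sheets Y (E \<union> F) g = Y \<times> {0} \<union> GE \<union> GF" (is "_ = ?T")
  proof (intro equalityI subsetI)
    fix p assume "p \<in> sheets Y (E \<union> F) g"
    then consider "p \<in> Y \<times> {0}" | y where "y \<in> E - C" "p = (y, infdist y C)"
      | y where "y \<in> F" "p = (y, infdist y D)"
      | y where "y \<in> C" "p = (y, infdist y D)"
      by (auto simp: sheets_def g_def split: if_splits)
    then show "p \<in> ?T"
      using C(1) by cases (auto simp: GE_def GF_def)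
  next
    fix p assume "p \<in> ?T"
    then consider "p \<in> Y \<times> {0}" | y where "y \<in> E" "p = (y, infdist y C)"
      | y where "y \<in> F" "p = (y, infdist y D)"
      by (auto simp: GE_def GF_def)
    then show "p \<in> sheets Y (E \<union> F) g"
    proof cases
      case (2 y)
      then show ?thesis
        using E(2) by (cases "y \<in> C") (auto simp: sheets_def g_def)
    next
      case (3 y)
      then show ?thesis
      proof (cases "y \<in> D")
        case False
        then have "g y = infdist y D"
          using 3(1) D(4) by (auto simp: g_def)
        then show ?thesis
          using 3 by (auto simp: sheets_def image_iff)
      qed (use F(2) in \<open>auto simp: sheets_def\<close>)
    qed (auto simp: sheets_def)
  qed
  obtain c d where cd: "c \<in> C" "d \<in> D"
    using C(2) D(1) by blast
  then have "c \<in> E" "d \<in> F" "c \<in> Y" "d \<in> Y"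
    using C(1) D(4) E(2) by auto
  then have "(c, 0) \<in> GE" "(d, 0) \<in> GF" "(c, 0) \<in> Y \<times> {0::real}" "(d, 0) \<in> Y \<times> {0::real}"
    using cd by (auto simp: GE_def GF_def image_iff)
  then have "connected ((Y \<times> {0} \<union> GE) \<union> GF)"
    using continuum_base[OF Y] G by (intro connected_Un) auto
  moreover have "compact (Y \<times> {0} \<union> GE \<union> GF)"
    using continuum_base[OF Y] G by (intro compact_Un)
  ultimately show ?thesis
    using two_to_one_retract_partial_sheetI[OF Y, of "E \<union> F" g] pos eq cEF E F
    by (auto simp: continuum_def)
qed

section \<open>Disconnected sheets over a continuum that is not a retract\<close>

lemma compact_sheets_subset:
  fixes Y :: "'a::metric_space set"
  assumes "compact (sheets Y Y g)" "A \<subseteq> Y" "compact A"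
  shows "compact (sheets A A g)"
proof -
  have "sheets A A g = sheets Y Y g \<inter> (A \<times> UNIV)"
    using assms(2) by (auto simp: sheets_def)
  moreover have "closed (A \<times> (UNIV :: real set))"
    using assms(3) by (simp add: closed_Times compact_imp_closed)
  ultimately show ?thesis
    using assms(1) by (simp add: compact_Int_closed)
qed

text \<open>
  If \<open>B\<close> is not a 2-to-1 retract, the sheets over \<open>B\<close> are disconnected. The point is to have a clopen
  set \<open>W\<close> whose trace over \<open>K\<close> stays inside a given nonempty clopen part \<open>Q\<close> of the upper sheet over \<open>K\<close>.
  For this the remaining part \<open>G\<close> is pushed down to the bottom by the map \<open>\<phi>\<close>, which cuts heights off
  at the distance to \<open>G\<close> and therefore moves no point onto the bottom except those of \<open>G\<close>. The missing
  upper points, over \<open>K - C\<close> with \<open>C\<close> the projection of \<open>Q\<close>, are supplied by the graph \<open>\<Gamma>\<close> of the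
  distance to \<open>C\<close> over \<open>K\<close>. A clopen set \<open>W'\<close> of these new sheets that avoids the bottom avoids all of
  \<open>\<Gamma>\<close>, which is connected and touches the bottom over \<open>C\<close>; the preimage of \<open>W'\<close> under \<open>\<phi>\<close> is the
  desired set.
\<close>

lemma nonretract_split:
  fixes B :: "'a::metric_space set"
  assumes B: "continuum B" "\<not> two_to_one_retract B"
    and g: "\<And>y. y \<in> B \<Longrightarrow> 0 < g y" and T: "compact (sheets B B g)"
    and K: "K \<subseteq> B" "compact K" "connected K"
    and Q: "Q \<subseteq> sheets K K g" "Q \<noteq> {}" "compact Q" "Q \<inter> K \<times> {0} = {}"
    and G: "compact (sheets K K g - Q)"
  obtains W where "W \<subseteq> sheets B B g" "W \<noteq> {}" "compact W" "compact (sheets B B g - W)"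
    "W \<inter> B \<times> {0} = {}" "W \<inter> sheets K K g \<subseteq> Q"
proof -
  define G where "G = sheets K K g - Q"
  define C where "C = fst ` Q"
  have QC: "Q = (\<lambda>y. (y, g y)) ` C" and CK: "C \<subseteq> K"
  proof -
    have "p = (fst p, g (fst p)) \<and> fst p \<in> K" if "p \<in> Q" for p
      using that Q(1,4) by (auto simp: sheets_def)
    then show "Q = (\<lambda>y. (y, g y)) ` C" "C \<subseteq> K"
      by (force simp: C_def)+
  qed
  have C: "closed C" "C \<noteq> {}"
    using Q(2,3) unfolding C_def
    by (auto intro!: compact_imp_closed compact_continuous_image continuous_intros)
  have KG: "K \<times> {0} \<subseteq> G"
    using Q(4) by (auto simp: G_def sheets_def)
  have G': "closed G" "G \<noteq> {}"
    using G C(2) CK KG by (auto simp: G_def compact_imp_closed)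
  define \<phi> :: "'a \<times> real \<Rightarrow> 'a \<times> real" where "\<phi> p = (fst p, min (snd p) (infdist p G))" for p
  define \<Gamma> where "\<Gamma> = (\<lambda>y. (y, infdist y C)) ` K"
  define g' where "g' y = (if y \<in> K - C then infdist y C else min (g y) (infdist (y, g y) G))" for y
  have \<phi>0: "\<phi> (y, 0) = (y, 0)" for y
    by (simp add: \<phi>_def infdist_nonneg)
  have upper: "(y, g y) \<in> G \<longleftrightarrow> y \<in> K - C" if "y \<in> B" for y
    using g[OF that] by (auto simp: G_def QC sheets_def image_iff)
  have pos: "0 < g' y" if "y \<in> B" for y
    using g[OF that] upper[OF that] C G' by (auto simp: g'_def infdist_pos_not_in_closed)
  have \<phi>1: "\<phi> (y, g y) = (if y \<in> K - C then (y, 0) else (y, g' y))" if "y \<in> B" for y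
    using g[OF that] upper[OF that] by (auto simp: \<phi>_def g'_def)
  have eq: "sheets B B g' = \<phi> ` sheets B B g \<union> \<Gamma>"
  proof (intro equalityI subsetI)
    fix p assume "p \<in> sheets B B g'"
    then obtain y where y: "y \<in> B" "p = (y, 0) \<or> p = (y, g' y)"
      by (auto simp: sheets_def)
    have "(y, 0) \<in> \<phi> ` sheets B B g"
      using y(1) by (intro image_eqI[of _ _ "(y, 0)"]) (auto simp: \<phi>0 sheets_def)
    moreover have "(y, g' y) \<in> \<Gamma>" if "y \<in> K - C"
      using that by (auto simp: \<Gamma>_def g'_def)
    moreover have "(y, g' y) \<in> \<phi> ` sheets B B g" if "y \<notin> K - C"
      using that y(1) \<phi>1[OF y(1)]
      by (intro image_eqI[of _ _ "(y, g y)"]) (auto simp: sheets_def)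
    ultimately show "p \<in> \<phi> ` sheets B B g \<union> \<Gamma>"
      using y(2) by blast
  next
    fix p assume "p \<in> \<phi> ` sheets B B g \<union> \<Gamma>"
    then consider y where "y \<in> B" "p = \<phi> (y, 0)" | y where "y \<in> B" "p = \<phi> (y, g y)"
      | y where "y \<in> K" "p = (y, infdist y C)"
      by (auto simp: sheets_def \<Gamma>_def)
    then show "p \<in> sheets B B g'"
    proof cases
      case (3 y)
      then show ?thesis
        using K(1) by (cases "y \<in> C") (auto simp: sheets_def g'_def)
    qed (auto simp: \<phi>0 \<phi>1 sheets_def)
  qed
  have cont: "continuous_on UNIV \<phi>"
    unfolding \<phi>_def by (intro continuous_intros)
  have \<Gamma>: "compact \<Gamma>" "connected \<Gamma>"
    unfolding \<Gamma>_def using K by (auto intro!: compact_graph connected_graph continuous_intros)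
  have "compact (sheets B B g')"
    unfolding eq using T \<Gamma>(1) cont
    by (intro compact_Un compact_continuous_image) (auto intro: continuous_on_subset)
  moreover from this have "\<not> connected (sheets B B g')"
    using B pos two_to_one_retract_sheetsI by blast
  moreover have "connected (B \<times> {0::real})"
    using B(1) by (rule continuum_base)
  moreover have "B \<times> {0} \<subseteq> sheets B B g'"
    by (auto simp: sheets_def)
  ultimately obtain W' where W': "W' \<subseteq> sheets B B g'" "W' \<noteq> {}" "compact W'"
      "compact (sheets B B g' - W')" "B \<times> {0} \<inter> W' = {}"
    by (rule disconnected_compact_split)
  obtain c where c: "c \<in> C" "(c, 0) \<in> \<Gamma>" "c \<in> B"
    using C(2) CK K(1) by (force simp: \<Gamma>_def)
  have "\<Gamma> \<inter> W' = {} \<or> \<Gamma> \<inter> W' = \<Gamma>"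
  proof (rule connected_compact_split[OF \<Gamma>(2)])
    have "\<Gamma> - \<Gamma> \<inter> W' = \<Gamma> \<inter> (sheets B B g' - W')"
      using eq by auto
    then show "compact (\<Gamma> - \<Gamma> \<inter> W')"
      using \<Gamma>(1) W'(4) by (simp add: compact_Int)
  qed (use \<Gamma>(1) W'(3) in \<open>auto intro: compact_Int\<close>)
  then have \<Gamma>W': "\<Gamma> \<inter> W' = {}"
    using c W'(5) by blast
  define W where "W = sheets B B g \<inter> \<phi> -` W'"
  show thesis
  proof (rule that)
    show "W \<subseteq> sheets B B g" by (auto simp: W_def)
    show "W \<noteq> {}"
      using W'(1,2) \<Gamma>W' eq by (force simp: W_def)
    have "closed (\<phi> -` W')" "closed (\<phi> -` (sheets B B g' - W'))"
      using W'(3,4) cont by (simp_all add: closed_vimage compact_imp_closed)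
    moreover have "sheets B B g - W = sheets B B g \<inter> \<phi> -` (sheets B B g' - W')"
      using eq by (auto simp: W_def)
    ultimately show "compact W" "compact (sheets B B g - W)"
      using T by (auto simp: W_def intro: compact_Int_closed)
    show "W \<inter> B \<times> {0} = {}"
      using W'(5) \<phi>0 by (force simp: W_def)
    show "W \<inter> sheets K K g \<subseteq> Q"
    proof
      fix p assume p: "p \<in> W \<inter> sheets K K g"
      show "p \<in> Q"
      proof (rule ccontr)
        assume "p \<notin> Q"
        then have "p \<in> G" "fst p \<in> B"
          using p K(1) by (auto simp: G_def sheets_def)
        moreover have "0 \<le> snd p"
          using p K(1) g by (force simp: sheets_def intro: less_imp_le)
        ultimately have "\<phi> p \<in> B \<times> {0}"
          by (simp add: \<phi>_def)
        then show False
          using p W'(5) by (auto simp: W_def)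
      qed
    qed
  qed
qed

section \<open>Unions of two continua with connected intersection\<close>

text \<open>Clopen parts of the sheets over \<open>A\<close> and over \<open>B\<close> that agree over \<open>A \<inter> B\<close> glue to a clopen part of
  the sheets over \<open>A \<union> B\<close>. A nonempty pair of this kind that avoids the bottom is produced from the
  assumption that neither \<open>A\<close> nor \<open>B\<close> is a 2-to-1 retract.\<close>

lemma two_to_one_retract_Un_connected_Int:
  fixes A B :: "'a::metric_space set"
  assumes A: "continuum A" "\<not> two_to_one_retract A"
    and B: "continuum B" and K: "A \<inter> B \<noteq> {}" "connected (A \<inter> B)"
    and AB: "two_to_one_retract (A \<union> B)"
  shows "two_to_one_retract B"
proof (rule ccontr)
  assume nB: "\<not> two_to_one_retract B"
  define X where "X = A \<union> B"
  define K where "K = A \<inter> B"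
  obtain g where g: "\<And>y. y \<in> X \<Longrightarrow> 0 < g y" and T: "compact (sheets X X g)" "connected (sheets X X g)"
    using AB two_to_one_retract_imp_sheets unfolding X_def by blast
  define TA where "TA = sheets A A g"
  define TB where "TB = sheets B B g"
  define TK where "TK = sheets K K g"
  have K': "compact K" "connected K" "K \<subseteq> B" "K \<subseteq> A" "continuum K"
    using assms(1,3,4,5) by (auto simp: K_def continuum_def intro: compact_Int)
  have c: "compact TA" "compact TB" "compact TK"
    unfolding TA_def TB_def TK_def using A(1) B K'
    by (auto intro!: compact_sheets_subset[OF T(1)] simp: X_def continuum_def)
  have TAB: "TA \<union> TB = sheets X X g" "TA \<inter> TB = TK"
    by (auto simp: TA_def TB_def TK_def sheets_def X_def K_def)
  have "\<not> connected TA"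
    using A c(1) g two_to_one_retract_sheetsI[of A g] by (auto simp: TA_def X_def)
  moreover have "connected (A \<times> {0::real})"
    using A(1) by (rule continuum_base)
  moreover have "A \<times> {0} \<subseteq> TA" by (auto simp: TA_def sheets_def)
  ultimately obtain Q where Q: "Q \<subseteq> TA" "Q \<noteq> {}" "compact Q" "compact (TA - Q)" "A \<times> {0} \<inter> Q = {}"
    by (rule disconnected_compact_split[OF c(1)])
  \<comment> \<open>Clopen parts with the same trace on \<open>TK\<close> have a clopen union, which must be trivial since
    the sheets over \<open>X\<close> are connected.\<close>
  have glue: "Q' \<union> W = {}"
    if "Q' \<subseteq> TA" "W \<subseteq> TB" "compact Q'" "compact (TA - Q')" "compact W" "compact (TB - W)"
      "Q' \<inter> TK = W \<inter> TK" "(Q' \<union> W) \<inter> A \<times> {0} = {}" for Q' W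
  proof -
    have "sheets X X g - (Q' \<union> W) = (TA - Q') \<union> (TB - W)"
      using that(1,2,7) TAB by blast
    then have "compact (sheets X X g - (Q' \<union> W))"
      using that by (auto intro: compact_Un)
    then have "Q' \<union> W = {} \<or> Q' \<union> W = sheets X X g"
      using that TAB by (intro connected_compact_split[OF T(2)]) (auto intro: compact_Un)
    moreover have "A \<times> {0} \<subseteq> sheets X X g" "A \<noteq> {}"
      using A(1) by (auto simp: sheets_def X_def continuum_def)
    ultimately show ?thesis
      using that(8) by blast
  qed
  have upper: "p = (fst p, g (fst p))" if "p \<in> Q" for p
  proof -
    have "p \<notin> A \<times> {0}"
      using that Q(5) by blast
    then show ?thesis
      using that Q(1) by (auto simp: TA_def sheets_def)
  qed
  have "Q \<inter> TK \<noteq> {}"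
  proof
    assume "Q \<inter> TK = {}"
    then show False
      using glue[of Q "{}"] Q c(2) by auto
  qed
  moreover have "TK - (Q \<inter> TK) = TK \<inter> (TA - Q)"
    using TAB by blast
  then have "compact (TK - (Q \<inter> TK))"
    using c(3) Q(4) by (simp add: compact_Int)
  moreover have "Q \<inter> TK \<inter> K \<times> {0} = {}"
    using Q(5) K'(4) by auto
  moreover have "\<And>y. y \<in> B \<Longrightarrow> 0 < g y"
    using g by (simp add: X_def)
  ultimately obtain W where W: "W \<subseteq> TB" "W \<noteq> {}" "compact W" "compact (TB - W)"
      "W \<inter> B \<times> {0} = {}" "W \<inter> TK \<subseteq> Q \<inter> TK"
    using nonretract_split[OF B nB _ c(2)[unfolded TB_def] K'(3,1,2), of "Q \<inter> TK"] c(3) Q(3)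
    unfolding TB_def TK_def by (metis compact_Int inf_le2)
  \<comment> \<open>\<open>W\<close> cuts \<open>Q \<inter> TK\<close> into two compact parts; this cut is to be extended to \<open>Q\<close>.\<close>
  define F1 where "F1 = W \<inter> TK"
  define F2 where "F2 = Q \<inter> TK \<inter> (TB - W)"
  have F: "compact F1" "compact F2" "F1 \<subseteq> Q" "F2 \<subseteq> Q" "F1 \<inter> F2 = {}" "F1 \<union> F2 = Q \<inter> TK"
    using W Q(3) c(3) TAB by (auto simp: F1_def F2_def intro: compact_Int)
  obtain Q1 where Q1: "Q1 \<subseteq> Q" "compact Q1" "compact (Q - Q1)" "F1 \<subseteq> Q1" "Q1 \<inter> F2 = {}"
  proof (rule compact_cut_wire[OF Q(3) F(1-4)])
    fix L assume L: "L \<subseteq> Q" "compact L" "connected L"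
    show "L \<inter> F1 = {} \<or> L \<inter> F2 = {}"
    proof (rule ccontr)
      assume "\<not> ?thesis"
      then have ne: "L \<inter> F1 \<noteq> {}" "L \<inter> F2 \<noteq> {}" by auto
      \<comment> \<open>Projection is injective on the upper sheet, so such an \<open>L\<close> would project to a subcontinuum
        \<open>E\<close> of \<open>A\<close> whose intersection with \<open>K\<close> is disconnected.\<close>
      define E where "E = fst ` L"
      have E: "continuum E" "E \<subseteq> A"
        using L ne(1) Q(1) unfolding E_def continuum_def
        by (auto intro!: compact_continuous_image connected_continuous_image continuous_intros
            simp: TA_def sheets_def)
      have inj: "p = q" if "p \<in> Q" "q \<in> Q" "fst p = fst q" for p q
        using upper[OF that(1)] upper[OF that(2)] that(3) by simp
      have disj: "fst ` (L \<inter> F1) \<inter> fst ` (L \<inter> F2) = {}"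
        using inj F(3-5) by blast
      have EK: "E \<inter> K = fst ` (L \<inter> F1) \<union> fst ` (L \<inter> F2)"
      proof -
        have "E \<inter> K = fst ` (L \<inter> TK)"
          using L(1) Q(1) by (force simp: E_def TK_def TA_def sheets_def)
        also have "L \<inter> TK = (L \<inter> F1) \<union> (L \<inter> F2)"
          using L(1) F(6) by blast
        finally show ?thesis by (simp add: image_Un)
      qed
      have cl: "closed (fst ` (L \<inter> F1))" "closed (fst ` (L \<inter> F2))"
        using L(2) F(1,2)
        by (auto intro!: compact_imp_closed compact_continuous_image compact_Int continuous_intros)
      have "\<not> connected (E \<inter> K)"
        using connected_as_closed_union[OF _ EK cl] ne disj by blast
      then show False
        using two_to_one_retract_nonunicoherent[OF A(1) E K'(5,4)] A(2) by blast
    qed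
  qed
  have "TA - Q1 = (TA - Q) \<union> (Q - Q1)"
    using Q1(1) Q(1) by blast
  then have "compact (TA - Q1)"
    using Q(4) Q1(3) by (simp add: compact_Un)
  moreover have "Q1 \<inter> TK = W \<inter> TK"
    using Q1 F(6) by (auto simp: F1_def)
  moreover have "W \<inter> A \<times> {0} = {}"
    using W(1,5) by (auto simp: TB_def sheets_def)
  ultimately have "Q1 \<union> W = {}"
    using Q(1,5) Q1(1,2) W by (intro glue) auto
  then show False using W(2) by simp
qed

theorem theorem6:
  fixes X A B :: "'a::metric_space set"
  assumes "decomposable_continuum X"
    and "X = A \<union> B"
    and "proper_subcontinuum A X"
    and "proper_subcontinuum B X"
  shows "two_to_one_retract X \<longleftrightarrow>
           two_to_one_retract A \<or> two_to_one_retract B \<or> \<not> connected (A \<inter> B)"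
proof -
  have X: "continuum X" and A: "continuum A" "A \<subseteq> X" and B: "continuum B" "B \<subseteq> X"
    using assms by (auto simp: decomposable_continuum_def proper_subcontinuum_def)
  have "A \<inter> B \<noteq> {}"
    using connected_as_closed_union[of X A B] X A B assms(2)
    by (auto simp: continuum_def compact_imp_closed)
  then show ?thesis
    using two_to_one_retract_Un_connected_Int[OF A(1) _ B(1)] assms(2)
      two_to_one_retract_superset[OF X A] two_to_one_retract_superset[OF X B]
      two_to_one_retract_nonunicoherent[OF X A B]
    by blast
qed

end
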